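(* For each $i\in N$, let $f_i:X\times X\times X_i\to 2^{Y_i}$ be a correspondence with nonempty and closed values. For each $i\in N$, suppose that: a) $A_i,F_i$ have nonempty, convex values and open lower sections; b) $f_i(\cdot,x_i,\cdot,y_i,\cdot):X_{-i}\times X_{-i}\times X_i\to 2^{Y_i}$ is upper semicontinuous for each $(x_i,y_i)\in X_i\times X_i$; c) the correspondence $W_i:X_{-i}\to 2^{Y_i}$, defined by $W_i(x_{-i})=Y_i\setminus(-\mathrm{int}\,C_i(x_{-i}))$ for each $x_{-i}\in X_{-i}$, is upper semicontinuous; d) for each $(x_{-i},y_{-i})\in X_{-i}\times X_{-i}$, there exists $(x_i,y_i)\in A_i(x_{-i})\times F_i(y_{-i})$ such that $f_i(x,y,\overline{A}_i(x_{-i}))\subseteq\mathrm{int}\,C_i(x_{-i})$; e) for each $(x_{-i},y_{-i},u_i)\in X_{-i}\times X_{-i}\times X_i$, $f_i(x_{-i},\cdot,y_{-i},\cdot,u_i):X_i\times X_i\to 2^{Y_i}$ is $(-\mathrm{int}\,C_i(x_{-i}))$-quasi-convex-like. Then there exists a pair $(x^*,y^* )\in X\times X$ such that for each $i\in N$, $x_i^*\in A_i(x^*_{-i})$, $y_i^*\in F_i(y^*_{-i})$ and $f_i(x^*,y^*,u_i)\subseteq C_i(x^*_{-i})$ for each $u_i\in A_i(x^*_{-i})$.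
   Context: Setting. $N=\{1,\dots,n\}$ is finite. For each $i\in N$, $X_i$ is a nonempty convex compact subset of a Hausdorff locally convex space $E_i$ and $Y_i$ is a topological vector space. $X=\prod_{i\in N}X_i$, $X_{-i}=\prod_{j\neq i}X_j$; for $x\in X$ write $x=(x_{-i},x_i)$, and similarly $y=(y_{-i},y_i)$; $f_i(x,y,u_i)$ is also written $f_i(x_{-i},x_i,y_{-i},y_i,u_i)$. For $B\subset X_i$, $f_i(x,y,B)=\bigcup_{u\in B}f_i(x,y,u)$. A correspondence is a set-valued map. For each $i\in N$, $A_i,F_i:X_{-i}\to 2^{X_i}$ and $C_i:X_{-i}\to 2^{Y_i}$ are correspondences with nonempty values, and for each $x_{-i}\in X_{-i}$, $C_i(x_{-i})$ is a proper, closed and convex cone with $\mathrm{int}\,C_i(x_{-i})\neq\emptyset$. Definitions. For a correspondence $T:U\to 2^V$ between topological spaces: $T$ has open lower sections if $\{u\in U:v\in T(u)\}$ is open for each $v\in V$; $T$ is upper semicontinuous if for each $u\in U$ and each open $O\supset T(u)$ there is an open neighborhood $U'$ of $u$ with $T(u')\subset O$ for all $u'\in U'$; $\overline{T}(u)=\{v\in V:(u,v)\in\mathrm{cl}_{U\times V}\,\mathrm{Gr}\,T\}$. For $K$ convex, $Y$ a topological vector space and $D\subset Y$, a correspondence $G:K\to 2^Y$ is $D$-quasi-convex-like if for any $k_1,k_2\in K$ and $\lambda\in[0,1]$ either $G(\lambda k_1+(1-\lambda)k_2)\subseteq G(k_1)-D$ or $G(\lambda k_1+(1-\lambda)k_2)\subseteq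 G(k_2)-D$. *)

theory Defs
  imports "HOL-Analysis.Analysis"
begin

text \<open>
  The spaces of a finite family are in general pairwise different, so they cannot be types here.
  A real topological vector space is a topology whose carrier is a linear subspace of an ambient
  type of class \<^class>\<open>real_vector\<close>, which itself carries no topology. The topologies on different
  subspaces are unrelated. Every finite family of topological vector spaces arises in this way, by
  embedding the spaces in their direct sum.
\<close>

definition topological_vector_space :: "'a::real_vector topology \<Rightarrow> bool" where
  "topological_vector_space E \<longleftrightarrow>
     subspace (topspace E) \<and>
     continuous_map (prod_topology E E) E (\<lambda>(x, y). x + y) \<and>
     continuous_map (prod_topology euclideanreal E) E (\<lambda>(c, x). c *\<^sub>R x)"

definition locally_convex_space :: "'a::real_vector topology \<Rightarrow> bool" where
  "locally_convex_space E \<longleftrightarrow> topological_vector_space E \<and> neighbourhood_base_of convex E"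

text \<open>
  A correspondence \<open>T : U \<rightarrow> 2\<^sup>V\<close> is a set-valued function; only its values on \<open>U\<close> matter.
\<close>

definition open_lower_sections :: "'a topology \<Rightarrow> 'b topology \<Rightarrow> ('a \<Rightarrow> 'b set) \<Rightarrow> bool" where
  "open_lower_sections U V T \<longleftrightarrow> (\<forall>v\<in>topspace V. openin U {u \<in> topspace U. v \<in> T u})"

definition upper_semicontinuous :: "'a topology \<Rightarrow> 'b topology \<Rightarrow> ('a \<Rightarrow> 'b set) \<Rightarrow> bool" where
  "upper_semicontinuous U V T \<longleftrightarrow>
     (\<forall>u\<in>topspace U. \<forall>Q. openin V Q \<and> T u \<subseteq> Q \<longrightarrow>
        (\<exists>U'. openin U U' \<and> u \<in> U' \<and> (\<forall>u'\<in>U'. T u' \<subseteq> Q)))"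

definition graph_closure :: "'a topology \<Rightarrow> 'b topology \<Rightarrow> ('a \<Rightarrow> 'b set) \<Rightarrow> 'a \<Rightarrow> 'b set" where
  "graph_closure U V T u =
     {v \<in> topspace V. (u, v) \<in>
        prod_topology U V closure_of {(u', v'). u' \<in> topspace U \<and> v' \<in> topspace V \<and> v' \<in> T u'}}"

definition quasi_convex_like ::
  "'b::real_vector set \<Rightarrow> 'a::real_vector set \<Rightarrow> ('a \<Rightarrow> 'b set) \<Rightarrow> bool" where
  "quasi_convex_like D K G \<longleftrightarrow>
     (\<forall>k1\<in>K. \<forall>k2\<in>K. \<forall>l\<in>{0..1}.
        G (l *\<^sub>R k1 + (1 - l) *\<^sub>R k2) \<subseteq> {a - d | a d. a \<in> G k1 \<and> d \<in> D} \<or>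
        G (l *\<^sub>R k1 + (1 - l) *\<^sub>R k2) \<subseteq> {a - d | a d. a \<in> G k2 \<and> d \<in> D})"

text \<open>
  Points of \<open>X\<^sub>-\<^sub>i\<close> are functions on \<open>{1..n} - {i}\<close>, extensional outside it. For \<open>x\<close> in
  \<open>X\<^sub>-\<^sub>i\<close> and \<open>a\<close> in \<open>X\<^sub>i\<close>, the point \<open>(x, a)\<close> of \<open>X\<close> is the update \<open>x(i := a)\<close>; for \<open>x\<close> in \<open>X\<close>,
  its component \<open>x\<^sub>-\<^sub>i\<close> is \<open>others n i x\<close>.
\<close>

definition profiles :: "nat \<Rightarrow> (nat \<Rightarrow> 'a set) \<Rightarrow> (nat \<Rightarrow> 'a) set" where
  "profiles n X = Pi\<^sub>E {1..n} X"

definition other_profiles :: "nat \<Rightarrow> (nat \<Rightarrow> 'a set) \<Rightarrow> nat \<Rightarrow> (nat \<Rightarrow> 'a) set" where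
  "other_profiles n X i = Pi\<^sub>E ({1..n} - {i}) X"

definition others :: "nat \<Rightarrow> nat \<Rightarrow> (nat \<Rightarrow> 'a) \<Rightarrow> (nat \<Rightarrow> 'a)" where
  "others n i x = restrict x ({1..n} - {i})"

definition other_profiles_top ::
  "nat \<Rightarrow> (nat \<Rightarrow> 'a topology) \<Rightarrow> (nat \<Rightarrow> 'a set) \<Rightarrow> nat \<Rightarrow> (nat \<Rightarrow> 'a) topology" where
  "other_profiles_top n E X i =
     product_topology (\<lambda>j. subtopology (E j) (X j)) ({1..n} - {i})"

end

theory Submission
  imports Defs
begin

text \<open>
  For a pair of profiles \<open>(x, y)\<close> let \<open>S\<^sub>i(x, y)\<close> be the set of pairs \<open>(a, b)\<close> with
  \<open>a \<in> A\<^sub>i(x\<^sub>-\<^sub>i)\<close>, \<open>b \<in> F\<^sub>i(y\<^sub>-\<^sub>i)\<close> and \<open>f\<^sub>i((x\<^sub>-\<^sub>i, a), (y\<^sub>-\<^sub>i, b), u) \<subseteq> int C\<^sub>i(x\<^sub>-\<^sub>i)\<close> for every \<open>u\<close> in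
  the graph closure of \<open>A\<^sub>i\<close> at \<open>x\<^sub>-\<^sub>i\<close>. A pair \<open>(x, y)\<close> with \<open>(x\<^sub>i, y\<^sub>i) \<in> S\<^sub>i(x, y)\<close> for every \<open>i\<close>
  solves the problem. The sets \<open>S\<^sub>i(x, y)\<close> are nonempty by hypothesis \<open>d\<close>. They are convex,
  because quasi-convexity places the value at a convex combination inside \<open>int C + int C \<subseteq> int C\<close>
  (\<open>convex_quasi_convex_like_sublevel\<close>). So Browder's fixed point theorem for
  correspondences with open lower sections, in the form for finite products
  (\<open>family_fixed_point\<close>), applies once the lower sections of every \<open>S\<^sub>i\<close> are known to be open.

  Openness is the delicate point: a value of \<open>f\<^sub>i\<close> and the complement of an open cone are closed sets,
  neither of them compact in general, in a space that need not be normal, so disjointness alone does not separate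
  them. Instead, upper semicontinuity of \<open>x \<mapsto> Y \<setminus> (-int C(x))\<close> is a strong condition, because the values
  are unions of rays. Take \<open>e \<in> int C(x)\<close>. The complement of \<open>-(e + C(x))\<close> is an open neighbourhood of
  \<open>Y \<setminus> (-int C(x))\<close>, and every ray in \<open>-int C(x)\<close> eventually leaves it. Hence the nearby values, which it
  contains, meet no such ray, and this says that \<open>int C(x) \<subseteq> int C(x')\<close> for all \<open>x'\<close> near \<open>x\<close>
  (\<open>interior_cone_locally_increasing\<close>). The inclusion \<open>f \<subseteq> int C\<close> is therefore stable under small
  perturbations by the upper semicontinuity of \<open>f\<close> alone, and the quantifier over \<open>u\<close> is harmless because
  \<open>u\<close> ranges over the sections of a closed subset of a product with a compact factor
  (\<open>openin_forall_compact\<close>).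

  Browder's theorem is reduced, by a partition of unity, to a fixed point of a continuous self-map of
  a simplex. As the number of vertices comes out of a compactness argument, no fixed Euclidean type can
  carry these simplices; they are placed in the Hilbert cube, whose fixed point property follows from
  Kuhn's combinatorial lemma (\<open>hilbert_cube_fixed_point\<close>).
\<close>

section \<open>The fixed point property of the Hilbert cube\<close>

definition hilbert_cube :: "(nat \<Rightarrow> real) set" where
  "hilbert_cube = {x. \<forall>i. x i \<in> {0..1}}"

lemma compact_hilbert_cube: "compact hilbert_cube"
proof -
  have "compactin (product_topology (\<lambda>i::nat. euclideanreal) UNIV) (Pi\<^sub>E UNIV (\<lambda>i. {0..1}))"
    by (auto simp: compactin_PiE)
  moreover have "Pi\<^sub>E UNIV (\<lambda>i::nat. {0..1::real}) = hilbert_cube"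
    by (auto simp: hilbert_cube_def)
  ultimately show ?thesis
    by (simp add: euclidean_product_topology)
qed

lemma tendsto_fun_iff:
  fixes l :: "'a \<Rightarrow> 'b::topological_space"
  shows "(g \<longlongrightarrow> l) G \<longleftrightarrow> (\<forall>i. ((\<lambda>n. g n i) \<longlongrightarrow> l i) G)"
  using limitin_componentwise[of "\<lambda>i::'a. euclidean::'b topology" UNIV g l G]
  by (simp add: euclidean_product_topology)

text \<open>
  Kuhn's lemma on the grid of mesh \<open>1/p\<close> in the first \<open>p\<close> coordinates gives one grid cell in which each of
  these coordinates does not decrease under \<open>h\<close> at one vertex and does not increase at another.
  Letting the dimension of the grid grow together with its fineness makes one limit passage suffice for
  infinitely many coordinates.
\<close>

lemma approximate_fixed_point:
  fixes h :: "(nat \<Rightarrow> real) \<Rightarrow> nat \<Rightarrow> real"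
    and p :: nat
  assumes h: "h \<in> hilbert_cube \<rightarrow> hilbert_cube" and "0 < p"
  obtains z where "z \<in> hilbert_cube"
    and "\<And>i. i < p \<Longrightarrow> \<exists>r\<in>hilbert_cube. \<exists>s\<in>hilbert_cube.
      (\<forall>j. \<bar>r j - z j\<bar> \<le> 1 / p) \<and> (\<forall>j. \<bar>s j - z j\<bar> \<le> 1 / p) \<and> r i \<le> h r i \<and> h s i \<le> s i"
proof -
  define pt :: "(nat \<Rightarrow> nat) \<Rightarrow> nat \<Rightarrow> real" where
    "pt x = (\<lambda>j. if j < p then real (x j) / real p else 0)" for x
  \<comment> \<open>The two boundary cases make the labels obey the boundary conditions of Kuhn's lemma; in each
     case label 0 means that the coordinate does not decrease, and label 1 that it does not increase.\<close>
  define label :: "(nat \<Rightarrow> nat) \<Rightarrow> nat \<Rightarrow> nat" where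
    "label x i = (if x i = 0 then 0 else if x i = p then 1
                  else if pt x i \<le> h (pt x) i then 0 else 1)" for x i
  obtain q where q: "\<forall>i<p. q i < p" and rs: "\<forall>i<p. \<exists>r s.
      (\<forall>j<p. q j \<le> r j \<and> r j \<le> q j + 1) \<and> (\<forall>j<p. q j \<le> s j \<and> s j \<le> q j + 1) \<and>
      label r i \<noteq> label s i"
  proof (rule kuhn_lemma)
    show "\<forall>x. (\<forall>i<p. x i \<le> p) \<longrightarrow> (\<forall>i<p. x i = p \<longrightarrow> label x i = 1)"
      using \<open>0 < p\<close> by (simp add: label_def)
  qed (use \<open>0 < p\<close> in \<open>simp_all add: label_def\<close>)
  have pt_cube: "pt x \<in> hilbert_cube" if "\<forall>j<p. x j \<le> p" for x
    using that \<open>0 < p\<close> by (auto simp: hilbert_cube_def pt_def)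
  have near: "\<bar>pt x j - pt q j\<bar> \<le> 1 / p" if "\<forall>j<p. q j \<le> x j \<and> x j \<le> q j + 1" for x j
  proof (cases "j < p")
    case True
    then have "real (x j) - real (q j) \<in> {0..1}"
      using that by force
    then have "\<bar>(real (x j) - real (q j)) / p\<bar> \<le> 1 / p"
      using \<open>0 < p\<close> by (simp add: divide_right_mono)
    then show ?thesis
      using True by (simp add: pt_def diff_divide_distrib)
  qed (simp add: pt_def)
  have h01: "0 \<le> h (pt x) i" "h (pt x) i \<le> 1" if "\<forall>j<p. x j \<le> p" for x i
    using h pt_cube[of x] that by (auto simp: hilbert_cube_def Pi_iff)
  have pt0: "x i = 0 \<Longrightarrow> pt x i = 0" and pt1: "x i = p \<Longrightarrow> i < p \<Longrightarrow> pt x i = 1" for x i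
    using \<open>0 < p\<close> by (simp_all add: pt_def)
  have up: "pt x i \<le> h (pt x) i" if "label x i = 0" "i < p" "\<forall>j<p. x j \<le> p" for x i
    using that h01[of x i] pt0[of x i] pt1[of x i] by (auto simp: label_def split: if_splits)
  have down: "h (pt x) i \<le> pt x i" if "label x i \<noteq> 0" "i < p" "\<forall>j<p. x j \<le> p" for x i
    using that h01[of x i] pt0[of x i] pt1[of x i] by (auto simp: label_def split: if_splits)
  show thesis
  proof
    show "pt q \<in> hilbert_cube"
      using q by (intro pt_cube) (simp add: less_imp_le)
    fix i assume i: "i < p"
    then obtain r s where
      r: "\<forall>j<p. q j \<le> r j \<and> r j \<le> q j + 1" and
      s: "\<forall>j<p. q j \<le> s j \<and> s j \<le> q j + 1" and ne: "label r i \<noteq> label s i"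
      using rs by blast
    have le_p: "x j \<le> p" if "j < p" "x j \<le> q j + 1" for x :: "nat \<Rightarrow> nat" and j
      using q that by fastforce
    have rp: "\<forall>j<p. r j \<le> p" and sp: "\<forall>j<p. s j \<le> p"
      using r s le_p by blast+
    have r': "pt r \<in> hilbert_cube" "\<forall>j. \<bar>pt r j - pt q j\<bar> \<le> 1 / p"
      using pt_cube rp near r by blast+
    have s': "pt s \<in> hilbert_cube" "\<forall>j. \<bar>pt s j - pt q j\<bar> \<le> 1 / p"
      using pt_cube sp near s by blast+
    show "\<exists>r\<in>hilbert_cube. \<exists>s\<in>hilbert_cube. (\<forall>j. \<bar>r j - pt q j\<bar> \<le> 1 / p) \<and>
            (\<forall>j. \<bar>s j - pt q j\<bar> \<le> 1 / p) \<and> r i \<le> h r i \<and> h s i \<le> s i"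
    proof (cases "label r i = 0")
      case True
      then have "pt r i \<le> h (pt r) i" "h (pt s) i \<le> pt s i"
        using ne up[OF _ i rp] down[OF _ i sp] by auto
      with r' s' show ?thesis
        by blast
    next
      case False
      then have "label s i = 0"
        using ne by (auto simp: label_def split: if_splits)
      with False have "pt s i \<le> h (pt s) i" "h (pt r) i \<le> pt r i"
        using up[OF _ i sp] down[OF _ i rp] by auto
      with r' s' show ?thesis
        by blast
    qed
  qed
qed

text \<open>
  At a limit point of cells of shrinking mesh, the vertices where coordinate \<open>i\<close> does not decrease and those
  where it does not increase converge to the same point, so by continuity that coordinate is fixed.
\<close>

proposition hilbert_cube_fixed_point:
  fixes h :: "(nat \<Rightarrow> real) \<Rightarrow> nat \<Rightarrow> real"
  assumes cont: "continuous_on hilbert_cube h" and h: "h \<in> hilbert_cube \<rightarrow> hilbert_cube"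
  obtains x where "x \<in> hilbert_cube" "h x = x"
proof -
  have "\<forall>k. \<exists>z\<in>hilbert_cube. \<forall>i<Suc k. \<exists>r\<in>hilbert_cube. \<exists>s\<in>hilbert_cube.
      (\<forall>j. \<bar>r j - z j\<bar> \<le> 1 / Suc k) \<and> (\<forall>j. \<bar>s j - z j\<bar> \<le> 1 / Suc k) \<and>
      r i \<le> h r i \<and> h s i \<le> s i"
    using approximate_fixed_point[OF h] by (metis zero_less_Suc)
  then obtain z where zH: "\<And>k. z k \<in> hilbert_cube"
    and z: "\<And>k. \<forall>i<Suc k. \<exists>r\<in>hilbert_cube. \<exists>s\<in>hilbert_cube.
      (\<forall>j. \<bar>r j - z k j\<bar> \<le> 1 / Suc k) \<and> (\<forall>j. \<bar>s j - z k j\<bar> \<le> 1 / Suc k) \<and>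
      r i \<le> h r i \<and> h s i \<le> s i"
    by metis
  obtain x \<sigma> where xH: "x \<in> hilbert_cube" and \<sigma>: "strict_mono \<sigma>" and lim: "(z \<circ> \<sigma>) \<longlonglongrightarrow> x"
    using compact_hilbert_cube zH unfolding compact_eq_seq_compact_metric seq_compact_def by metis
  have "h x i = x i" for i
  proof -
    \<comment> \<open>Kuhn's cells of dimension at most \<open>i\<close> say nothing about coordinate \<open>i\<close>, hence the shift.\<close>
    define \<tau> where "\<tau> k = \<sigma> (k + i)" for k
    have "k + i \<le> \<tau> k" for k
      unfolding \<tau>_def by (rule seq_suble[OF \<sigma>])
    then have le_\<tau>: "i < Suc (\<tau> k)" "k \<le> \<tau> k" for k
      by (meson add_leD1 add_leD2 le_imp_less_Suc)+
    have limj: "(\<lambda>k. z (\<tau> k) j) \<longlonglongrightarrow> x j" for j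
      using LIMSEQ_ignore_initial_segment[OF lim, of i] by (simp add: tendsto_fun_iff o_def \<tau>_def)
    have conv: "(\<lambda>k. w k i) \<longlonglongrightarrow> x i \<and> (\<lambda>k. h (w k) i) \<longlonglongrightarrow> h x i"
      if near: "\<And>k j. \<bar>w k j - z (\<tau> k) j\<bar> \<le> 1 / Suc (\<tau> k)" and w: "\<And>k. w k \<in> hilbert_cube"
      for w
    proof -
      have "(\<lambda>k. w k j) \<longlonglongrightarrow> x j" for j
      proof -
        have "norm (w k j - z (\<tau> k) j) \<le> 1 / Suc k" for k
          using near[of k j] le_\<tau>(2)[of k] by (smt (verit) Suc_le_mono frac_le of_nat_0_less_iff
              of_nat_le_iff real_norm_def zero_less_Suc)
        then have "(\<lambda>k. w k j - z (\<tau> k) j) \<longlonglongrightarrow> 0"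
          by (intro Lim_null_comparison[OF _ lim_inverse_n'[THEN LIMSEQ_Suc]] always_eventually) auto
        from tendsto_add[OF this limj[of j]] show ?thesis
          by simp
      qed
      then have lim_w: "w \<longlonglongrightarrow> x"
        by (simp add: tendsto_fun_iff)
      have "(\<lambda>k. h (w k)) \<longlonglongrightarrow> h x"
        by (rule continuous_on_tendsto_compose[OF cont lim_w xH]) (simp add: w)
      then show ?thesis
        using lim_w by (simp add: tendsto_fun_iff)
    qed
    have "\<exists>r s. r \<in> hilbert_cube \<and> s \<in> hilbert_cube \<and>
        (\<forall>j. \<bar>r j - z (\<tau> k) j\<bar> \<le> 1 / Suc (\<tau> k)) \<and> (\<forall>j. \<bar>s j - z (\<tau> k) j\<bar> \<le> 1 / Suc (\<tau> k)) \<and>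
        r i \<le> h r i \<and> h s i \<le> s i" for k
      using z[of "\<tau> k"] le_\<tau>(1)[of k] by blast
    then obtain r s where rs: "\<And>k. r k \<in> hilbert_cube" "\<And>k. s k \<in> hilbert_cube"
      "\<And>k j. \<bar>r k j - z (\<tau> k) j\<bar> \<le> 1 / Suc (\<tau> k)"
      "\<And>k j. \<bar>s k j - z (\<tau> k) j\<bar> \<le> 1 / Suc (\<tau> k)"
      "\<And>k. r k i \<le> h (r k) i" "\<And>k. h (s k) i \<le> s k i"
      by metis
    have "x i \<le> h x i"
      using conv[of r] rs by (intro LIMSEQ_le[of "\<lambda>k. r k i" _ "\<lambda>k. h (r k) i"]) auto
    moreover have "h x i \<le> x i"
      using conv[of s] rs by (intro LIMSEQ_le[of "\<lambda>k. h (s k) i" _ "\<lambda>k. s k i"]) auto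
    ultimately show ?thesis
      by simp
  qed
  with xH show thesis
    by (intro that[of x]) auto
qed

section \<open>Simplices and partitions of unity\<close>

text \<open>
  The simplices of all dimensions live in one type, so that the number of vertices may depend on the
  data of a proof.
\<close>

definition unit_simplex :: "nat \<Rightarrow> (nat \<Rightarrow> real) set" where
  "unit_simplex m = {t. (\<forall>j. 0 \<le> t j) \<and> (\<forall>j\<ge>m. t j = 0) \<and> (\<Sum>j<m. t j) = 1}"

lemma unit_simplex_fixed_point:
  fixes s :: "(nat \<Rightarrow> real) \<Rightarrow> nat \<Rightarrow> real"
  assumes "0 < m" and cont: "continuous_on (unit_simplex m) s"
    and s: "s \<in> unit_simplex m \<rightarrow> unit_simplex m"
  obtains t where "t \<in> unit_simplex m" "s t = t"
proof -
  \<comment> \<open>A retraction of the cube onto the simplex: mass missing from the total 1 is put on vertex 0,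
     and excess mass is removed by rescaling.\<close>
  define r :: "(nat \<Rightarrow> real) \<Rightarrow> nat \<Rightarrow> real" where
    "r t = (\<lambda>j. if j < m then (t j + (if j = 0 then max 0 (1 - (\<Sum>i<m. t i)) else 0)) /
                  max 1 (\<Sum>i<m. t i) else 0)" for t
  have r_simplex: "r t \<in> unit_simplex m" if "t \<in> hilbert_cube" for t
  proof -
    have nonneg: "0 \<le> t j" for j
      using that by (auto simp: hilbert_cube_def)
    have "(\<Sum>j<m. r t j) = (\<Sum>j<m. t j + (if j = 0 then max 0 (1 - (\<Sum>i<m. t i)) else 0)) /
        max 1 (\<Sum>i<m. t i)"
      by (simp add: r_def sum_divide_distrib)
    also have "\<dots> = ((\<Sum>j<m. t j) + max 0 (1 - (\<Sum>i<m. t i))) / max 1 (\<Sum>i<m. t i)"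
      using \<open>0 < m\<close> by (simp add: sum.distrib)
    also have "\<dots> = 1"
      by (simp add: max_def)
    finally show ?thesis
      using nonneg by (auto simp: unit_simplex_def r_def intro!: divide_nonneg_pos add_nonneg_nonneg)
  qed
  have r_id: "r t = t" if "t \<in> unit_simplex m" for t
    using that by (auto simp: r_def unit_simplex_def)
  have sub: "unit_simplex m \<subseteq> hilbert_cube"
  proof
    fix t assume t: "t \<in> unit_simplex m"
    have "t j \<le> 1" for j
    proof (cases "j < m")
      case True
      then have "t j \<le> (\<Sum>i<m. t i)"
        using t by (intro member_le_sum) (auto simp: unit_simplex_def)
      then show ?thesis
        using t by (simp add: unit_simplex_def)
    qed (use t in \<open>simp add: unit_simplex_def\<close>)
    then show "t \<in> hilbert_cube"
      using t by (simp add: unit_simplex_def hilbert_cube_def)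
  qed
  have coord: "continuous_on S (\<lambda>t. t j)" for S :: "(nat \<Rightarrow> real) set" and j
    by (intro continuous_on_product_then_coordinatewise[OF continuous_on_id])
  have "continuous_on hilbert_cube r"
  proof (rule continuous_on_coordinatewise_then_product)
    fix j
    have "max 1 (\<Sum>i<m. t i) \<noteq> 0" for t :: "nat \<Rightarrow> real"
      by linarith
    then have "continuous_on hilbert_cube
        (\<lambda>t. (t j + (if j = 0 then max 0 (1 - (\<Sum>i<m. t i)) else 0)) / max 1 (\<Sum>i<m. t i))"
      by (cases "j = 0") (auto intro!: continuous_intros coord)
    then show "continuous_on hilbert_cube (\<lambda>t. r t j)"
      by (cases "j < m") (simp_all add: r_def)
  qed
  then have "continuous_on hilbert_cube (s \<circ> r)"
    using r_simplex by (intro continuous_on_compose continuous_on_subset[OF cont]) auto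
  moreover have "s \<circ> r \<in> hilbert_cube \<rightarrow> hilbert_cube"
    using r_simplex s sub by fastforce
  ultimately obtain t where "t \<in> hilbert_cube" "s (r t) = t"
    using hilbert_cube_fixed_point[of "s \<circ> r"] by auto
  moreover from this have "t \<in> unit_simplex m"
    using s r_simplex by (metis PiE)
  ultimately show thesis
    using that r_id by metis
qed

text \<open>
  Each \<open>z\<close> has a nonnegative continuous function that is positive at \<open>z\<close> and vanishes off \<open>V z\<close>. By
  compactness finitely many of them have a positive sum, and dividing by that sum
  normalizes them.
\<close>

lemma partition_of_unity:
  assumes "compact_space Z" and reg: "completely_regular_space Z"
    and V: "\<And>z. z \<in> topspace Z \<Longrightarrow> openin Z (V z) \<and> z \<in> V z"
  obtains m and z :: "nat \<Rightarrow> 'a" and \<phi> :: "nat \<Rightarrow> 'a \<Rightarrow> real"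
  where "z \<in> {..<m} \<rightarrow> topspace Z"
    and "\<And>j. j < m \<Longrightarrow> continuous_map Z euclideanreal (\<phi> j)"
    and "\<And>j w. \<lbrakk>j < m; w \<in> topspace Z\<rbrakk> \<Longrightarrow> 0 \<le> \<phi> j w"
    and "\<And>w. w \<in> topspace Z \<Longrightarrow> (\<Sum>j<m. \<phi> j w) = 1"
    and "\<And>j w. \<lbrakk>j < m; w \<in> topspace Z; \<phi> j w \<noteq> 0\<rbrakk> \<Longrightarrow> w \<in> V (z j)"
proof -
  have "\<exists>g. continuous_map Z euclideanreal g \<and> (\<forall>w\<in>topspace Z. 0 \<le> g w) \<and> 0 < g z \<and>
      (\<forall>w\<in>topspace Z. g w \<noteq> 0 \<longrightarrow> w \<in> V z)" if z: "z \<in> topspace Z" for z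
  proof -
    have "closedin Z (topspace Z - V z)" "z \<in> topspace Z - (topspace Z - V z)"
      using V[OF z] z by auto
    then obtain k :: "'a \<Rightarrow> real" where k: "continuous_map Z (top_of_set {0..1}) k" "k z = 0"
      "k ` (topspace Z - V z) \<subseteq> {1}"
      using reg unfolding completely_regular_space_def by metis
    then have "continuous_map Z euclideanreal k" "\<forall>w\<in>topspace Z. k w \<le> 1"
      by (auto simp: continuous_map_in_subtopology Pi_iff)
    moreover have "continuous_map Z euclideanreal (\<lambda>w. 1 - k w)"
      by (intro continuous_intros calculation)
    moreover have "w \<in> V z" if "w \<in> topspace Z" "1 - k w \<noteq> 0" for w
      using k(3) that by auto
    ultimately show ?thesis
      using k(2) by (intro exI[of _ "\<lambda>w. 1 - k w"]) simp
  qed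
  then have "\<exists>g. \<forall>z\<in>topspace Z. continuous_map Z euclideanreal (g z) \<and>
      (\<forall>w\<in>topspace Z. 0 \<le> g z w) \<and> 0 < g z z \<and> (\<forall>w\<in>topspace Z. g z w \<noteq> 0 \<longrightarrow> w \<in> V z)"
    by (intro bchoice) blast
  then obtain g where g: "\<And>z. z \<in> topspace Z \<Longrightarrow> continuous_map Z euclideanreal (g z)"
    and g0: "\<And>z w. \<lbrakk>z \<in> topspace Z; w \<in> topspace Z\<rbrakk> \<Longrightarrow> 0 \<le> g z w"
    and gpos: "\<And>z. z \<in> topspace Z \<Longrightarrow> 0 < g z z"
    and gV: "\<And>z w. \<lbrakk>z \<in> topspace Z; w \<in> topspace Z; g z w \<noteq> 0\<rbrakk> \<Longrightarrow> w \<in> V z"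
    by blast
  define P where "P z = {w \<in> topspace Z. g z w \<in> {0<..}}" for z
  have "openin Z (P z)" if "z \<in> topspace Z" for z
    unfolding P_def using g[OF that] by (rule openin_continuous_map_preimage) simp
  moreover have "topspace Z \<subseteq> \<Union>(P ` topspace Z)"
    using gpos by (auto simp: P_def)
  ultimately have "\<exists>\<F>. finite \<F> \<and> \<F> \<subseteq> P ` topspace Z \<and> topspace Z \<subseteq> \<Union>\<F>"
    using \<open>compact_space Z\<close> unfolding compact_space_def by (intro compactinD) auto
  then obtain D where D: "finite D" "D \<subseteq> topspace Z" "topspace Z \<subseteq> \<Union>(P ` D)"
    by (auto simp: ex_finite_subset_image)
  obtain z :: "nat \<Rightarrow> 'a" where z: "bij_betw z {..<card D} D"
    using ex_bij_betw_nat_finite[OF D(1)] by (auto simp: atLeast0LessThan)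
  have zZ: "z j \<in> topspace Z" if "j < card D" for j
    using z D(2) that by (auto dest!: bij_betwE)
  define \<phi> where "\<phi> j w = g (z j) w / (\<Sum>i<card D. g (z i) w)" for j w
  have pos: "0 < (\<Sum>i<card D. g (z i) w)" if w: "w \<in> topspace Z" for w
  proof -
    obtain y where "y \<in> D" "w \<in> P y"
      using D(3) w by blast
    moreover obtain j where "j < card D" "z j = y"
      using \<open>y \<in> D\<close> bij_betw_imp_surj_on[OF z] by (metis imageE lessThan_iff)
    ultimately have "0 < g (z j) w"
      by (simp add: P_def)
    then show ?thesis
      using \<open>j < card D\<close> g0[OF zZ w] by (intro sum_pos2[of _ j]) auto
  qed
  show thesis
  proof
    show "z \<in> {..<card D} \<rightarrow> topspace Z"
      using zZ by simp
    show "continuous_map Z euclideanreal (\<phi> j)" if "j < card D" for j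
      unfolding \<phi>_def using that pos g zZ by (intro continuous_intros) force+
    show "0 \<le> \<phi> j w" if "j < card D" "w \<in> topspace Z" for j w
      unfolding \<phi>_def using that pos[of w] g0 zZ by (simp add: less_imp_le)
    show "(\<Sum>j<card D. \<phi> j w) = 1" if "w \<in> topspace Z" for w
      using pos[OF that] by (simp add: \<phi>_def flip: sum_divide_distrib)
    show "w \<in> V (z j)" if "j < card D" "w \<in> topspace Z" "\<phi> j w \<noteq> 0" for j w
      using that gV zZ by (auto simp: \<phi>_def)
  qed
qed

section \<open>Browder's fixed point theorem for a finite product\<close>

lemma subspace_topspace: "topological_vector_space E \<Longrightarrow> subspace (topspace E)"
  by (simp add: topological_vector_space_def)

lemma continuous_map_vector_add:
  assumes "topological_vector_space E" "continuous_map T E g" "continuous_map T E h"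
  shows "continuous_map T E (\<lambda>t. g t + h t)"
  using continuous_map_compose[OF continuous_map_pairedI[OF assms(2,3)], of E "\<lambda>(x, y). x + y"] assms(1)
  by (simp add: topological_vector_space_def o_def)

lemma continuous_map_vector_scale:
  assumes "topological_vector_space E" "continuous_map T euclideanreal c" "continuous_map T E g"
  shows "continuous_map T E (\<lambda>t. c t *\<^sub>R g t)"
  using continuous_map_compose[OF continuous_map_pairedI[OF assms(2,3)], of E "\<lambda>(c, x). c *\<^sub>R x"] assms(1)
  by (simp add: topological_vector_space_def o_def)

lemma continuous_map_linear_combination:
  assumes E: "topological_vector_space E" and "finite J"
    and "\<And>j. j \<in> J \<Longrightarrow> continuous_map T euclideanreal (\<lambda>t. c t j)"
    and "\<And>j. j \<in> J \<Longrightarrow> q j \<in> topspace E"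
  shows "continuous_map T E (\<lambda>t. \<Sum>j\<in>J. c t j *\<^sub>R q j)"
  using assms(2-)
proof (induction J rule: finite_induct)
  case empty
  then show ?case
    using subspace_0[OF subspace_topspace[OF E]] by simp
next
  case (insert j J)
  then show ?case
    by (simp add: continuous_map_vector_add[OF E] continuous_map_vector_scale[OF E])
qed

text \<open>
  Points of weight zero may lie anywhere. This matters below, where the weights are the values of a
  partition of unity and only the points of positive weight are known to lie in the convex set.
\<close>

lemma weighted_sum_in_convex:
  fixes q :: "'b \<Rightarrow> 'a::real_vector"
  assumes "convex S" "finite J" "\<And>j. j \<in> J \<Longrightarrow> 0 \<le> a j" "(\<Sum>j\<in>J. a j) = 1"
    and "\<And>j. \<lbrakk>j \<in> J; a j \<noteq> 0\<rbrakk> \<Longrightarrow> q j \<in> S"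
  shows "(\<Sum>j\<in>J. a j *\<^sub>R q j) \<in> S"
proof -
  have "(\<Sum>j\<in>{j\<in>J. a j \<noteq> 0}. a j *\<^sub>R q j) \<in> S"
  proof (rule convex_sum)
    have "sum a {j \<in> J. a j \<noteq> 0} = sum a J"
      using \<open>finite J\<close> by (intro sum.mono_neutral_left) auto
    then show "sum a {j \<in> J. a j \<noteq> 0} = 1"
      by (simp add: assms)
  qed (use assms in auto)
  also have "(\<Sum>j\<in>{j\<in>J. a j \<noteq> 0}. a j *\<^sub>R q j) = (\<Sum>j\<in>J. a j *\<^sub>R q j)"
    using \<open>finite J\<close> by (intro sum.mono_neutral_left) auto
  finally show ?thesis .
qed

text \<open>
  Choose a selection \<open>q z\<close> of the values at each \<open>z\<close>. By the open lower sections, \<open>q z\<close> remains a selection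
  at all points near \<open>z\<close>. Blending finitely many selections by a partition of unity gives a
  continuous selection with values in the convex hull of finitely many points, so its fixed point can be
  found by moving in a simplex of weights.
\<close>

proposition family_fixed_point:
  fixes E :: "'i \<Rightarrow> 'a::real_vector topology" and K :: "'i \<Rightarrow> 'a set"
    and I :: "'i set"
    and S :: "'i \<Rightarrow> ('i \<Rightarrow> 'a) \<Rightarrow> 'a set"
  defines "Z \<equiv> product_topology (\<lambda>i. subtopology (E i) (K i)) I"
  assumes "finite I" and E: "\<And>i. i \<in> I \<Longrightarrow> topological_vector_space (E i) \<and> Hausdorff_space (E i)"
    and K: "\<And>i. i \<in> I \<Longrightarrow> K i \<noteq> {} \<and> convex (K i) \<and> compactin (E i) (K i)"
    and S: "\<And>i z. \<lbrakk>i \<in> I; z \<in> topspace Z\<rbrakk> \<Longrightarrow> S i z \<noteq> {} \<and> S i z \<subseteq> K i \<and> convex (S i z)"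
    and lower: "\<And>i a. \<lbrakk>i \<in> I; a \<in> K i\<rbrakk> \<Longrightarrow> openin Z {z \<in> topspace Z. a \<in> S i z}"
  obtains z where "z \<in> topspace Z" "\<And>i. i \<in> I \<Longrightarrow> z i \<in> S i z"
proof -
  have KE: "topspace (subtopology (E i) (K i)) = K i" if "i \<in> I" for i
    using K[OF that] compactin_subset_topspace[of "E i" "K i"] by auto
  have topZ: "topspace Z = Pi\<^sub>E I K"
    unfolding Z_def topspace_product_topology using KE by (intro PiE_cong)
  have "compact_space Z"
    unfolding Z_def compact_space_product_topology using K compactin_subspace by blast
  moreover have "Hausdorff_space Z"
    unfolding Z_def Hausdorff_space_product_topology using E Hausdorff_space_subtopology by blast
  ultimately have "completely_regular_space Z"
    by (simp add: compact_Hausdorff_or_regular_imp_normal_space normal_imp_completely_regular_space)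
  define q where "q z = (\<lambda>i\<in>I. SOME a. a \<in> S i z)" for z
  have q: "q z i \<in> S i z" if "i \<in> I" "z \<in> topspace Z" for z i
    using S[OF that] that by (simp add: q_def some_in_eq)
  define V where "V z = {w \<in> topspace Z. \<forall>i\<in>I. q z i \<in> S i w}" for z
  have V: "openin Z (V z) \<and> z \<in> V z" if z: "z \<in> topspace Z" for z
  proof -
    have "V z = topspace Z \<inter> (\<Inter>i\<in>I. {w \<in> topspace Z. q z i \<in> S i w})"
      by (auto simp: V_def)
    moreover have "openin Z {w \<in> topspace Z. q z i \<in> S i w}" if "i \<in> I" for i
      using q[OF that z] S[OF that z] by (intro lower that) auto
    ultimately have "openin Z (V z)"
      using \<open>finite I\<close> by (cases "I = {}") (auto intro!: openin_Int openin_INT)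
    then show ?thesis
      using z q by (simp add: V_def)
  qed
  obtain m and \<zeta> :: "nat \<Rightarrow> 'i \<Rightarrow> 'a" and \<phi> :: "nat \<Rightarrow> ('i \<Rightarrow> 'a) \<Rightarrow> real"
    where \<zeta>: "\<zeta> \<in> {..<m} \<rightarrow> topspace Z"
    and \<phi>_cont: "\<And>j. j < m \<Longrightarrow> continuous_map Z euclideanreal (\<phi> j)"
    and \<phi>_nonneg: "\<And>j w. \<lbrakk>j < m; w \<in> topspace Z\<rbrakk> \<Longrightarrow> 0 \<le> \<phi> j w"
    and \<phi>_sum: "\<And>w. w \<in> topspace Z \<Longrightarrow> (\<Sum>j<m. \<phi> j w) = 1"
    and \<phi>_V: "\<And>j w. \<lbrakk>j < m; w \<in> topspace Z; \<phi> j w \<noteq> 0\<rbrakk> \<Longrightarrow> w \<in> V (\<zeta> j)"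
    by (rule partition_of_unity[OF \<open>compact_space Z\<close> \<open>completely_regular_space Z\<close> V])
      (assumption, rule that)
  have "topspace Z \<noteq> {}"
    using K by (simp add: topZ PiE_eq_empty_iff)
  then obtain w where "w \<in> topspace Z"
    by blast
  then have "0 < m"
    using \<phi>_sum[of w] by (cases m) auto
  define g where "g t = (\<lambda>i\<in>I. \<Sum>j<m. t j *\<^sub>R q (\<zeta> j) i)" for t :: "nat \<Rightarrow> real"
  have qK: "q (\<zeta> j) i \<in> K i" if "i \<in> I" "j < m" for i j
    using q[of i "\<zeta> j"] S[of i "\<zeta> j"] \<zeta> that by auto
  have gK: "(\<Sum>j<m. t j *\<^sub>R q (\<zeta> j) i) \<in> K i" if "i \<in> I" "t \<in> unit_simplex m" for t i
    using K[OF that(1)] that qK by (intro weighted_sum_in_convex) (auto simp: unit_simplex_def)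
  have g_cont: "continuous_map (top_of_set (unit_simplex m)) Z g"
    unfolding Z_def continuous_map_componentwise
  proof (intro conjI ballI)
    fix i assume i: "i \<in> I"
    have "continuous_map (top_of_set (unit_simplex m)) (E i) (\<lambda>t. \<Sum>j<m. t j *\<^sub>R q (\<zeta> j) i)"
    proof (rule continuous_map_linear_combination)
      show "continuous_map (top_of_set (unit_simplex m)) euclideanreal (\<lambda>t. t j)" for j
        by (simp add: continuous_on_product_then_coordinatewise[OF continuous_on_id])
      show "q (\<zeta> j) i \<in> topspace (E i)" if "j \<in> {..<m}" for j
        using qK[of i j] i that K[OF i] compactin_subset_topspace[of "E i" "K i"] by auto
    qed (use E i in auto)
    then show "continuous_map (top_of_set (unit_simplex m)) (subtopology (E i) (K i)) (\<lambda>t. g t i)"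
      using gK i by (auto simp: g_def continuous_map_in_subtopology)
  qed (auto simp: g_def)
  have gZ: "g t \<in> topspace Z" if "t \<in> unit_simplex m" for t
    using that g_cont by (auto simp: continuous_map_def)
  \<comment> \<open>From weights to the corresponding point, and from there to its values under the partition of
     unity: a self-map of the simplex whose fixed points are fixed points of the blended selection.\<close>
  define s where "s t = (\<lambda>j. if j < m then \<phi> j (g t) else 0)" for t
  have "continuous_on (unit_simplex m) s"
  proof (rule continuous_on_coordinatewise_then_product)
    fix j
    show "continuous_on (unit_simplex m) (\<lambda>t. s t j)"
      using continuous_map_compose[OF g_cont \<phi>_cont[of j]]
      by (cases "j < m") (simp_all add: s_def o_def)
  qed
  moreover have "s \<in> unit_simplex m \<rightarrow> unit_simplex m"
    using \<phi>_nonneg \<phi>_sum gZ by (auto simp: s_def unit_simplex_def)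
  ultimately obtain t where t: "t \<in> unit_simplex m" "s t = t"
    by (rule unit_simplex_fixed_point[OF \<open>0 < m\<close>])
  have tj: "t j = \<phi> j (g t)" if "j < m" for j
    using t(2) that by (metis s_def)
  have "g t i \<in> S i (g t)" if i: "i \<in> I" for i
  proof -
    have "(\<Sum>j<m. t j *\<^sub>R q (\<zeta> j) i) \<in> S i (g t)"
    proof (rule weighted_sum_in_convex)
      show "q (\<zeta> j) i \<in> S i (g t)" if "j \<in> {..<m}" "t j \<noteq> 0" for j
        using \<phi>_V[of j "g t"] that tj gZ[OF t(1)] i by (auto simp: V_def)
    qed (use S[OF i gZ[OF t(1)]] t(1) in \<open>auto simp: unit_simplex_def\<close>)
    then show ?thesis
      using i by (simp add: g_def)
  qed
  with gZ[OF t(1)] show thesis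
    by (rule that)
qed

text \<open>
  The unknowns of each player form a pair, so the theorem is used for the spaces \<open>E\<^sub>i \<times> E\<^sub>i\<close>.
\<close>

lemma topological_vector_space_prod:
  assumes E: "topological_vector_space E" and F: "topological_vector_space F"
  shows "topological_vector_space (prod_topology E F)"
  unfolding topological_vector_space_def
proof (intro conjI)
  show "subspace (topspace (prod_topology E F))"
    using subspace_topspace[OF E] subspace_topspace[OF F] by (simp add: subspace_Times)
  have "continuous_map (prod_topology (prod_topology E F) (prod_topology E F)) (prod_topology E F)
      (\<lambda>p. (fst (fst p) + fst (snd p), snd (fst p) + snd (snd p)))"
    by (intro continuous_map_pairedI continuous_map_vector_add E F
        continuous_map_fst continuous_map_snd
        continuous_map_compose[OF continuous_map_fst, unfolded o_def]
        continuous_map_compose[OF continuous_map_snd, unfolded o_def])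
  then show "continuous_map (prod_topology (prod_topology E F) (prod_topology E F))
      (prod_topology E F) (\<lambda>(x, y). x + y)"
    by (simp add: case_prod_unfold plus_prod_def)
  have "continuous_map (prod_topology euclideanreal (prod_topology E F)) (prod_topology E F)
      (\<lambda>p. (fst p *\<^sub>R fst (snd p), fst p *\<^sub>R snd (snd p)))"
    by (intro continuous_map_pairedI continuous_map_vector_scale E F
        continuous_map_fst continuous_map_snd
        continuous_map_compose[OF continuous_map_snd, unfolded o_def])
  then show "continuous_map (prod_topology euclideanreal (prod_topology E F))
      (prod_topology E F) (\<lambda>(c, x). c *\<^sub>R x)"
    by (simp add: case_prod_unfold scaleR_prod_def)
qed

section \<open>Cones in topological vector spaces\<close>

text \<open>
  The translate \<open>int C + w\<close> is open and contained in \<open>C\<close>.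
\<close>

lemma interior_cone_add:
  assumes Y: "topological_vector_space Y" and C: "convex C" "cone C" "C \<subseteq> topspace Y"
    and v: "v \<in> Y interior_of C" and w: "w \<in> C"
  shows "v + w \<in> Y interior_of C"
proof -
  note sub = subspace_topspace[OF Y]
  have wY: "- w \<in> topspace Y"
    using w C sub by (auto simp: subspace_neg)
  have vY: "v \<in> topspace Y"
    using v interior_of_subset_topspace by fast
  define O' where "O' = {u \<in> topspace Y. u + - w \<in> Y interior_of C}"
  have "continuous_map Y Y (\<lambda>u. u + - w)"
    using wY by (intro continuous_map_vector_add[OF Y]) auto
  then have "openin Y O'"
    unfolding O'_def by (rule openin_continuous_map_preimage) simp
  moreover have "O' \<subseteq> C"
  proof
    fix u assume "u \<in> O'"
    then have "u - w \<in> C"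
      using interior_of_subset by (fastforce simp: O'_def)
    then have "(u - w) + w \<in> C"
      using C w by (meson convex_cone)
    then show "u \<in> C"
      by simp
  qed
  ultimately have "O' \<subseteq> Y interior_of C"
    by (simp add: interior_of_maximal)
  moreover have "v + w \<in> O'"
    using v vY w C sub by (auto simp: O'_def subspace_add)
  ultimately show ?thesis
    by blast
qed

lemma interior_cone_scale:
  assumes Y: "topological_vector_space Y" and C: "cone C"
    and v: "v \<in> Y interior_of C" and "0 < c"
  shows "c *\<^sub>R v \<in> Y interior_of C"
proof -
  define O' where "O' = {u \<in> topspace Y. inverse c *\<^sub>R u \<in> Y interior_of C}"
  have "continuous_map Y Y (\<lambda>u. inverse c *\<^sub>R u)"
    by (intro continuous_map_vector_scale[OF Y]) auto
  then have "openin Y O'"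
    unfolding O'_def by (rule openin_continuous_map_preimage) simp
  moreover have "O' \<subseteq> C"
  proof
    fix u assume "u \<in> O'"
    then have "inverse c *\<^sub>R u \<in> C"
      using interior_of_subset by (fastforce simp: O'_def)
    then have "c *\<^sub>R (inverse c *\<^sub>R u) \<in> C"
      using C \<open>0 < c\<close> by (meson cone_def less_imp_le)
    then show "u \<in> C"
      using \<open>0 < c\<close> by simp
  qed
  ultimately have "O' \<subseteq> Y interior_of C"
    by (simp add: interior_of_maximal)
  moreover have "v \<in> topspace Y"
    using v interior_of_subset_topspace by fast
  then have "c *\<^sub>R v \<in> O'"
    using v \<open>0 < c\<close> subspace_topspace[OF Y] by (auto simp: O'_def subspace_scale)
  ultimately show ?thesis
    by blast
qed

text \<open>
  Since \<open>v\<close> is an interior point, \<open>v - s e\<close> is still in the cone for some small \<open>s > 0\<close>; scale by \<open>1/s\<close>.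
\<close>

lemma interior_cone_absorbs:
  assumes Y: "topological_vector_space Y" and C: "cone C"
    and v: "v \<in> Y interior_of C" and e: "e \<in> topspace Y"
  obtains t where "0 < t" "t *\<^sub>R v - e \<in> C"
proof -
  have vY: "v \<in> topspace Y"
    using v interior_of_subset_topspace by fast
  have "continuous_map euclideanreal Y (\<lambda>s. v + s *\<^sub>R - e)"
    using vY e subspace_topspace[OF Y]
    by (intro continuous_map_vector_add[OF Y] continuous_map_vector_scale[OF Y])
       (auto simp: subspace_neg)
  then have "openin euclideanreal {s \<in> topspace euclideanreal. v + s *\<^sub>R - e \<in> Y interior_of C}"
    by (rule openin_continuous_map_preimage) simp
  then have "open {s. v + s *\<^sub>R - e \<in> Y interior_of C}"
    by simp
  moreover have "0 \<in> {s. v + s *\<^sub>R - e \<in> Y interior_of C}"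
    using v by simp
  ultimately obtain d where "0 < d" "ball 0 d \<subseteq> {s. v + s *\<^sub>R - e \<in> Y interior_of C}"
    by (meson open_contains_ball)
  moreover from this have "d / 2 \<in> ball 0 d"
    by (simp add: dist_real_def)
  ultimately have "v + (d / 2) *\<^sub>R - e \<in> C"
    using interior_of_subset by fastforce
  then have "(2 / d) *\<^sub>R (v + (d / 2) *\<^sub>R - e) \<in> C"
    using C \<open>0 < d\<close> by (meson cone_def divide_nonneg_pos zero_le_numeral)
  then have "(2 / d) *\<^sub>R v - e \<in> C"
    using \<open>0 < d\<close> by (simp add: algebra_simps)
  then show thesis
    using \<open>0 < d\<close> by (intro that[of "2 / d"]) auto
qed

text \<open>
  Upper semicontinuity is tested on the complement \<open>Q\<close> of \<open>-(e + C x)\<close>, where \<open>e\<close> is interior to \<open>C x\<close>.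
  The value at \<open>x\<close> lies in \<open>Q\<close> because \<open>e + C x \<subseteq> int (C x)\<close>. If a vector \<open>v \<in> int (C x)\<close> were not in
  \<open>int (C x')\<close>, then all the negative multiples of \<open>v\<close> would belong to the value at \<open>x'\<close>, hence to \<open>Q\<close>,
  although \<open>t v \<in> e + C x\<close> for large \<open>t\<close>.
\<close>

lemma interior_cone_locally_increasing:
  assumes Y: "topological_vector_space Y" and x: "x \<in> topspace U"
    and C: "\<And>x. x \<in> topspace U \<Longrightarrow> closedin Y (C x) \<and> convex (C x) \<and> cone (C x)"
    and ne: "Y interior_of C x \<noteq> {}"
    and usc: "upper_semicontinuous U Y (\<lambda>x. topspace Y - uminus ` (Y interior_of C x))"
  obtains U' where "openin U U'" "x \<in> U'" "\<And>x'. x' \<in> U' \<Longrightarrow> Y interior_of C x \<subseteq> Y interior_of C x'"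
proof -
  note sub = subspace_topspace[OF Y]
  obtain e where e: "e \<in> Y interior_of C x"
    using ne by blast
  then have eY: "e \<in> topspace Y"
    using interior_of_subset_topspace by fast
  have CY: "C x \<subseteq> topspace Y"
    using C[OF x] by (simp add: closedin_subset)
  define Q where "Q = topspace Y - {v \<in> topspace Y. - 1 *\<^sub>R v + - e \<in> C x}"
  have "continuous_map Y Y (\<lambda>v. - 1 *\<^sub>R v + - e)"
    using eY sub by (intro continuous_map_vector_add[OF Y] continuous_map_vector_scale[OF Y])
      (auto simp: subspace_neg)
  then have "closedin Y {v \<in> topspace Y. - 1 *\<^sub>R v + - e \<in> C x}"
    by (rule closedin_continuous_map_preimage) (use C[OF x] in simp)
  then have "openin Y Q"
    by (simp add: Q_def openin_diff)
  moreover have "topspace Y - uminus ` (Y interior_of C x) \<subseteq> Q"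
  proof
    fix v assume v: "v \<in> topspace Y - uminus ` (Y interior_of C x)"
    have False if "- v - e \<in> C x"
    proof -
      have "e + (- v - e) \<in> Y interior_of C x"
        using C[OF x] CY by (intro interior_cone_add[OF Y _ _ _ e that]) auto
      then have "- (- v) \<in> uminus ` (Y interior_of C x)"
        by (intro imageI) simp
      then show False
        using v by simp
    qed
    then show "v \<in> Q"
      using v by (auto simp: Q_def)
  qed
  ultimately have "openin Y Q \<and> topspace Y - uminus ` (Y interior_of C x) \<subseteq> Q"
    by (rule conjI)
  from usc[unfolded upper_semicontinuous_def, rule_format, OF x this]
  obtain U' where U': "openin U U'" "x \<in> U'"
    and Q: "\<forall>x'\<in>U'. topspace Y - uminus ` (Y interior_of C x') \<subseteq> Q"
    by blast
  have "v \<in> Y interior_of C x'" if x': "x' \<in> U'" and v: "v \<in> Y interior_of C x" for x' v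
  proof (rule ccontr)
    assume not: "v \<notin> Y interior_of C x'"
    obtain t where t: "0 < t" "t *\<^sub>R v - e \<in> C x"
      using interior_cone_absorbs[OF Y _ v eY] C[OF x] by blast
    have "x' \<in> topspace U"
      using U'(1) x' openin_subset by blast
    have vY: "v \<in> topspace Y"
      using v interior_of_subset_topspace by fast
    have "t *\<^sub>R v \<notin> Y interior_of C x'"
    proof
      assume tv: "t *\<^sub>R v \<in> Y interior_of C x'"
      then have "inverse t *\<^sub>R (t *\<^sub>R v) \<in> Y interior_of C x'"
        using C[OF \<open>x' \<in> topspace U\<close>] t by (intro interior_cone_scale[OF Y _ tv]) auto
      then show False
        using not t by simp
    qed
    then have "- (t *\<^sub>R v) \<in> topspace Y - uminus ` (Y interior_of C x')"
      using vY sub by (auto simp: subspace_neg subspace_scale)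
    then have "- (t *\<^sub>R v) \<in> Q"
      using Q x' by blast
    then show False
      using t vY sub by (auto simp: Q_def subspace_neg subspace_scale)
  qed
  with U' show thesis
    by (intro that) auto
qed

text \<open>
  By \<open>interior_cone_locally_increasing\<close> the open set \<open>int (C (\<pi> s))\<close> is contained in all the nearby cones, so it
  can serve as the fixed target in the upper semicontinuity of \<open>g\<close>.
\<close>

lemma openin_values_in_interior_cone:
  assumes Y: "topological_vector_space Y" and \<pi>: "continuous_map S U \<pi>"
    and C: "\<And>x. x \<in> topspace U \<Longrightarrow> closedin Y (C x) \<and> convex (C x) \<and> cone (C x) \<and> Y interior_of C x \<noteq> {}"
    and C_usc: "upper_semicontinuous U Y (\<lambda>x. topspace Y - uminus ` (Y interior_of C x))"
    and g_usc: "upper_semicontinuous S Y g"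
  shows "openin S {s \<in> topspace S. g s \<subseteq> Y interior_of C (\<pi> s)}"
proof (subst openin_subopen, intro ballI)
  fix s assume "s \<in> {s \<in> topspace S. g s \<subseteq> Y interior_of C (\<pi> s)}"
  then have s: "s \<in> topspace S" "g s \<subseteq> Y interior_of C (\<pi> s)"
    by auto
  then have \<pi>s: "\<pi> s \<in> topspace U"
    using \<pi> by (auto simp: continuous_map_def)
  have cone: "closedin Y (C x) \<and> convex (C x) \<and> cone (C x)" if "x \<in> topspace U" for x
    using C[OF that] by simp
  have ne: "Y interior_of C (\<pi> s) \<noteq> {}"
    using C[OF \<pi>s] by simp
  obtain U' where U': "openin U U'" "\<pi> s \<in> U'"
    "\<And>x'. x' \<in> U' \<Longrightarrow> Y interior_of C (\<pi> s) \<subseteq> Y interior_of C x'"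
    by (rule interior_cone_locally_increasing[OF Y \<pi>s cone ne C_usc]) (assumption, rule that)
  obtain S' where S': "openin S S'" "s \<in> S'" "\<forall>s'\<in>S'. g s' \<subseteq> Y interior_of C (\<pi> s)"
    using g_usc[unfolded upper_semicontinuous_def, rule_format, OF s(1), of "Y interior_of C (\<pi> s)"] s(2)
    by auto
  have "openin S (S' \<inter> {s \<in> topspace S. \<pi> s \<in> U'})"
    by (intro openin_Int S' openin_continuous_map_preimage[OF \<pi>] U')
  then show "\<exists>T. openin S T \<and> s \<in> T \<and> T \<subseteq> {s \<in> topspace S. g s \<subseteq> Y interior_of C (\<pi> s)}"
    using s S' U' by (intro exI[of _ "S' \<inter> {s \<in> topspace S. \<pi> s \<in> U'}"]) fastforce
qed

section \<open>Lower sections and convexity of the constrained choices\<close>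

text \<open>
  Projection along a compact space is a closed map, so the parameters with a violating \<open>u\<close> form a
  closed set.
\<close>

lemma openin_forall_compact:
  assumes "compact_space K" "closedin (prod_topology Z K) G" "openin (prod_topology Z K) R"
  shows "openin Z {z \<in> topspace Z. \<forall>u. (z, u) \<in> G \<longrightarrow> (z, u) \<in> R}"
proof -
  have "closedin (prod_topology Z K) (G - R)"
    using assms by (simp add: closedin_diff)
  then have "closedin Z (fst ` (G - R))"
    using Abstract_Topological_Spaces.closed_map_fst[OF assms(1)] by (auto simp: closed_map_def)
  then have "openin Z (topspace Z - fst ` (G - R))"
    by blast
  also have "topspace Z - fst ` (G - R) = {z \<in> topspace Z. \<forall>u. (z, u) \<in> G \<longrightarrow> (z, u) \<in> R}"
    by force
  finally show ?thesis .
qed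

text \<open>
  Subtracting an element of \<open>-int C\<close> from a value contained in \<open>int C\<close> adds two elements of \<open>int C\<close>,
  and \<open>int C\<close> is closed under addition.
\<close>

lemma convex_quasi_convex_like_sublevel:
  assumes Y: "topological_vector_space Y" and C: "convex C" "cone C" "C \<subseteq> topspace Y"
    and "convex K" and G: "quasi_convex_like (uminus ` (Y interior_of C)) K G"
  shows "convex {k \<in> K. G k \<subseteq> Y interior_of C}"
proof (rule convexI)
  fix k1 k2 and u v :: real
  assume k: "k1 \<in> {k \<in> K. G k \<subseteq> Y interior_of C}" "k2 \<in> {k \<in> K. G k \<subseteq> Y interior_of C}"
    and uv: "0 \<le> u" "0 \<le> v" "u + v = 1"
  have sub: "{a - d |a d. a \<in> G k \<and> d \<in> uminus ` (Y interior_of C)} \<subseteq> Y interior_of C"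
    if "G k \<subseteq> Y interior_of C" for k
  proof clarify
    fix a c assume "a \<in> G k" "c \<in> Y interior_of C"
    then have "a + c \<in> Y interior_of C"
      using that interior_of_subset by (intro interior_cone_add[OF Y C]) fast+
    then show "a - - c \<in> Y interior_of C"
      by simp
  qed
  have v: "v = 1 - u" "u \<in> {0..1}"
    using uv by auto
  have "G (u *\<^sub>R k1 + v *\<^sub>R k2) \<subseteq> Y interior_of C"
    using G k v sub unfolding quasi_convex_like_def by (smt (verit, best) mem_Collect_eq subset_trans)
  moreover have "u *\<^sub>R k1 + v *\<^sub>R k2 \<in> K"
    using k uv \<open>convex K\<close> by (simp add: convexD)
  ultimately show "u *\<^sub>R k1 + v *\<^sub>R k2 \<in> {k \<in> K. G k \<subseteq> Y interior_of C}"
    by simp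
qed

lemma closedin_graph_closure:
  "closedin (prod_topology T K) {(u, v). u \<in> topspace T \<and> v \<in> graph_closure T K A u}"
proof -
  have "{(u, v). u \<in> topspace T \<and> v \<in> graph_closure T K A u} =
      prod_topology T K closure_of {(u, v). u \<in> topspace T \<and> v \<in> topspace K \<and> v \<in> A u}"
    using closure_of_subset_topspace[of "prod_topology T K"] by (fastforce simp: graph_closure_def)
  then show ?thesis
    by simp
qed

lemma subset_graph_closure:
  assumes "u \<in> topspace T" "v \<in> topspace K" "v \<in> A u"
  shows "v \<in> graph_closure T K A u"
proof -
  define Gr where "Gr = {(u', v'). u' \<in> topspace T \<and> v' \<in> topspace K \<and> v' \<in> A u'}"
  have "Gr \<subseteq> prod_topology T K closure_of Gr"
    by (intro closure_of_subset) (auto simp: Gr_def)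
  moreover have "(u, v) \<in> Gr"
    using assms by (simp add: Gr_def)
  ultimately show ?thesis
    using assms(2) by (auto simp: graph_closure_def simp flip: Gr_def)
qed

lemma graph_closure_subset: "graph_closure T K A u \<subseteq> topspace K"
  by (auto simp: graph_closure_def)

section \<open>Existence of an equilibrium pair\<close>

theorem theorem6:
  fixes n :: nat
    and E :: "nat \<Rightarrow> 'e::real_vector topology"
    and Y :: "nat \<Rightarrow> 'y::real_vector topology"
    and X :: "nat \<Rightarrow> 'e set"
    and A F :: "nat \<Rightarrow> (nat \<Rightarrow> 'e) \<Rightarrow> 'e set"
    and C :: "nat \<Rightarrow> (nat \<Rightarrow> 'e) \<Rightarrow> 'y set"
    and f :: "nat \<Rightarrow> (nat \<Rightarrow> 'e) \<Rightarrow> (nat \<Rightarrow> 'e) \<Rightarrow> 'e \<Rightarrow> 'y set"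
  assumes E: "\<And>i. i \<in> {1..n} \<Longrightarrow> locally_convex_space (E i) \<and> Hausdorff_space (E i)"
    and X: "\<And>i. i \<in> {1..n} \<Longrightarrow> X i \<noteq> {} \<and> convex (X i) \<and> compactin (E i) (X i)"
    and Y: "\<And>i. i \<in> {1..n} \<Longrightarrow> topological_vector_space (Y i)"
    and C: "\<And>i x. \<lbrakk>i \<in> {1..n}; x \<in> other_profiles n X i\<rbrakk> \<Longrightarrow>
          C i x \<noteq> {} \<and> C i x \<subset> topspace (Y i) \<and> closedin (Y i) (C i x) \<and>
          convex (C i x) \<and> cone (C i x) \<and> Y i interior_of C i x \<noteq> {}"
    and f: "\<And>i x y u. \<lbrakk>i \<in> {1..n}; x \<in> profiles n X; y \<in> profiles n X; u \<in> X i\<rbrakk> \<Longrightarrow>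
          f i x y u \<noteq> {} \<and> closedin (Y i) (f i x y u)"
    and a_A: "\<And>i x. \<lbrakk>i \<in> {1..n}; x \<in> other_profiles n X i\<rbrakk> \<Longrightarrow>
          A i x \<noteq> {} \<and> A i x \<subseteq> X i \<and> convex (A i x)"
    and a_F: "\<And>i x. \<lbrakk>i \<in> {1..n}; x \<in> other_profiles n X i\<rbrakk> \<Longrightarrow>
          F i x \<noteq> {} \<and> F i x \<subseteq> X i \<and> convex (F i x)"
    and a_open: "\<And>i. i \<in> {1..n} \<Longrightarrow>
          open_lower_sections (other_profiles_top n E X i) (subtopology (E i) (X i)) (A i) \<and>
          open_lower_sections (other_profiles_top n E X i) (subtopology (E i) (X i)) (F i)"
    and b: "\<And>i a b. \<lbrakk>i \<in> {1..n}; a \<in> X i; b \<in> X i\<rbrakk> \<Longrightarrow>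
          upper_semicontinuous
            (prod_topology (other_profiles_top n E X i)
              (prod_topology (other_profiles_top n E X i) (subtopology (E i) (X i))))
            (Y i)
            (\<lambda>(x, y, u). f i (x(i := a)) (y(i := b)) u)"
    and c: "\<And>i. i \<in> {1..n} \<Longrightarrow>
          upper_semicontinuous (other_profiles_top n E X i) (Y i)
            (\<lambda>x. topspace (Y i) - uminus ` (Y i interior_of C i x))"
    and d: "\<And>i x y. \<lbrakk>i \<in> {1..n}; x \<in> other_profiles n X i; y \<in> other_profiles n X i\<rbrakk> \<Longrightarrow>
          \<exists>a\<in>A i x. \<exists>b\<in>F i y.
            (\<Union>u\<in>graph_closure (other_profiles_top n E X i) (subtopology (E i) (X i)) (A i) x.
               f i (x(i := a)) (y(i := b)) u)
            \<subseteq> Y i interior_of C i x"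
    and e: "\<And>i x y u. \<lbrakk>i \<in> {1..n}; x \<in> other_profiles n X i; y \<in> other_profiles n X i; u \<in> X i\<rbrakk> \<Longrightarrow>
          quasi_convex_like (uminus ` (Y i interior_of C i x)) (X i \<times> X i)
            (\<lambda>(a, b). f i (x(i := a)) (y(i := b)) u)"
  shows "\<exists>x\<in>profiles n X. \<exists>y\<in>profiles n X. \<forall>i\<in>{1..n}.
           x i \<in> A i (others n i x) \<and> y i \<in> F i (others n i y) \<and>
           (\<forall>u\<in>A i (others n i x). f i x y u \<subseteq> C i (others n i x))"
proof -
  define K where "K i = subtopology (E i) (X i)" for i
  define T where "T i = other_profiles_top n E X i" for i
  define EE where "EE i = prod_topology (E i) (E i)" for i
  define Z where "Z = product_topology (\<lambda>i. subtopology (EE i) (X i \<times> X i)) {1..n}"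
  \<comment> \<open>A pair of profiles is stored as the single profile of pairs \<open>z i = (x i, y i)\<close>, because the
     condition on \<open>f\<close> couples \<open>x i\<close> and \<open>y i\<close>; \<open>\<pi> i z\<close> is \<open>x\<^sub>-\<^sub>i\<close> and \<open>\<rho> i z\<close> is \<open>y\<^sub>-\<^sub>i\<close>.\<close>
  define \<pi> where "\<pi> i z = others n i (\<lambda>j. fst (z j))" for i and z :: "nat \<Rightarrow> 'e \<times> 'e"
  define \<rho> where "\<rho> i z = others n i (\<lambda>j. snd (z j))" for i and z :: "nat \<Rightarrow> 'e \<times> 'e"
  define cl where "cl i = graph_closure (T i) (K i) (A i)" for i
  define S where "S i z = {(a, b). a \<in> A i (\<pi> i z) \<and> b \<in> F i (\<rho> i z) \<and>
      (\<forall>u\<in>cl i (\<pi> i z). f i ((\<pi> i z)(i := a)) ((\<rho> i z)(i := b)) u \<subseteq> Y i interior_of C i (\<pi> i z))}"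
    for i z
  have topK: "topspace (K i) = X i" if "i \<in> {1..n}" for i
    using X[OF that] compactin_subset_topspace[of "E i" "X i"] by (auto simp: K_def)
  have compK: "compact_space (K i)" if "i \<in> {1..n}" for i
    using X[OF that] by (simp add: K_def compact_space_subtopology)
  have Tdef: "T i = product_topology K ({1..n} - {i})" for i
    by (simp add: T_def other_profiles_top_def K_def[abs_def])
  have topT: "topspace (T i) = other_profiles n X i" for i
    unfolding Tdef topspace_product_topology other_profiles_def by (intro PiE_cong) (simp add: topK)
  have KK: "subtopology (EE i) (X i \<times> X i) = prod_topology (K i) (K i)" for i
    by (simp add: EE_def K_def subtopology_Times)
  have Zdef: "Z = product_topology (\<lambda>i. prod_topology (K i) (K i)) {1..n}"
    by (simp add: Z_def KK)
  have coord: "continuous_map Z (K j) (\<lambda>z. fst (z j))" "continuous_map Z (K j) (\<lambda>z. snd (z j))"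
    if "j \<in> {1..n}" for j
    using continuous_map_compose[OF continuous_map_product_projection[OF that] continuous_map_fst]
      continuous_map_compose[OF continuous_map_product_projection[OF that] continuous_map_snd]
    unfolding Zdef o_def by blast+
  have \<pi>: "continuous_map Z (T i) (\<pi> i)" and \<rho>: "continuous_map Z (T i) (\<rho> i)" for i
    unfolding Tdef continuous_map_componentwise \<pi>_def \<rho>_def others_def using coord by auto
  have \<pi>T: "\<pi> i z \<in> other_profiles n X i" and \<rho>T: "\<rho> i z \<in> other_profiles n X i"
    if "z \<in> topspace Z" for i z
    using that \<pi>[of i] \<rho>[of i] topT[of i] by (auto simp: continuous_map_def)
  have E2: "topological_vector_space (EE i) \<and> Hausdorff_space (EE i)" if "i \<in> {1..n}" for i
    using E[OF that] unfolding EE_def locally_convex_space_def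
    by (simp add: topological_vector_space_prod Hausdorff_space_prod_topology)
  have X2: "X i \<times> X i \<noteq> {} \<and> convex (X i \<times> X i) \<and> compactin (EE i) (X i \<times> X i)"
    if "i \<in> {1..n}" for i
    using X[OF that] by (simp add: EE_def compactin_Times convex_Times)
  have C': "closedin (Y i) (C i x) \<and> convex (C i x) \<and> cone (C i x) \<and> Y i interior_of C i x \<noteq> {}"
    if "i \<in> {1..n}" "x \<in> topspace (T i)" for i x
    using C[OF that(1)] that(2) by (simp add: topT)
  have S: "S i z \<noteq> {} \<and> S i z \<subseteq> X i \<times> X i \<and> convex (S i z)"
    if i: "i \<in> {1..n}" and z: "z \<in> topspace Z" for i z
  proof (intro conjI)
    note x = \<pi>T[OF z, of i] and y = \<rho>T[OF z, of i]
    obtain a b where "a \<in> A i (\<pi> i z)" "b \<in> F i (\<rho> i z)"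
      "(\<Union>u\<in>cl i (\<pi> i z). f i ((\<pi> i z)(i := a)) ((\<rho> i z)(i := b)) u) \<subseteq> Y i interior_of C i (\<pi> i z)"
      using d[OF i x y] unfolding cl_def T_def K_def by blast
    then have "(a, b) \<in> S i z"
      unfolding S_def by blast
    then show "S i z \<noteq> {}"
      by blast
    show "S i z \<subseteq> X i \<times> X i"
      using a_A[OF i x] a_F[OF i y] by (auto simp: S_def)
    define G where "G u = (\<lambda>(a, b). f i ((\<pi> i z)(i := a)) ((\<rho> i z)(i := b)) u)" for u
    have "S i z = (A i (\<pi> i z) \<times> F i (\<rho> i z)) \<inter>
        (\<Inter>u\<in>cl i (\<pi> i z). {k \<in> X i \<times> X i. G u k \<subseteq> Y i interior_of C i (\<pi> i z)})"
      using a_A[OF i x] a_F[OF i y] by (auto simp: S_def G_def)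
    moreover have "convex {k \<in> X i \<times> X i. G u k \<subseteq> Y i interior_of C i (\<pi> i z)}"
      if "u \<in> cl i (\<pi> i z)" for u
    proof (rule convex_quasi_convex_like_sublevel[OF Y[OF i]])
      have "u \<in> X i"
        using that graph_closure_subset[of "T i" "K i"] topK[OF i] unfolding cl_def by blast
      then show "quasi_convex_like (uminus ` (Y i interior_of C i (\<pi> i z))) (X i \<times> X i) (G u)"
        unfolding G_def by (rule e[OF i x y])
    qed (use C[OF i x] X2[OF i] in auto)
    ultimately show "convex (S i z)"
      using a_A[OF i x] a_F[OF i y] by (auto intro!: convex_Int convex_Times convex_INT)
  qed
  have lower: "openin Z {z \<in> topspace Z. k \<in> S i z}" if i: "i \<in> {1..n}" and k: "k \<in> X i \<times> X i" for i k
  proof -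
    obtain a b where ab: "k = (a, b)" "a \<in> X i" "b \<in> X i"
      using k by blast
    define P where "P = prod_topology (T i) (prod_topology (T i) (K i))"
    define R where "R = {s \<in> topspace P. (case s of (x, y, u) \<Rightarrow> f i (x(i := a)) (y(i := b)) u)
        \<subseteq> Y i interior_of C i (fst s)}"
    have "openin P R"
      unfolding R_def
    proof (rule openin_values_in_interior_cone[OF Y[OF i], where \<pi> = fst and U = "T i"])
      show "continuous_map P (T i) fst"
        unfolding P_def by (rule continuous_map_fst)
      show "upper_semicontinuous P (Y i) (\<lambda>(x, y, u). f i (x(i := a)) (y(i := b)) u)"
        using b[OF i ab(2,3)] by (simp add: P_def T_def K_def)
      show "upper_semicontinuous (T i) (Y i) (\<lambda>x. topspace (Y i) - uminus ` (Y i interior_of C i x))"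
        using c[OF i] by (simp add: T_def)
    qed (rule C'[OF i])
    define \<theta> where "\<theta> p = (\<pi> i (fst p), \<rho> i (fst p), snd p)" for p :: "(nat \<Rightarrow> 'e \<times> 'e) \<times> 'e"
    have \<pi>1: "continuous_map (prod_topology Z (K i)) (T i) (\<lambda>p. \<pi> i (fst p))"
      and \<rho>1: "continuous_map (prod_topology Z (K i)) (T i) (\<lambda>p. \<rho> i (fst p))"
      using continuous_map_compose[OF continuous_map_fst \<pi>] continuous_map_compose[OF continuous_map_fst \<rho>]
      unfolding o_def by blast+
    have "continuous_map (prod_topology Z (K i)) P \<theta>"
      unfolding P_def \<theta>_def by (intro continuous_map_pairedI \<pi>1 \<rho>1 continuous_map_snd)
    then have openR: "openin (prod_topology Z (K i)) {p \<in> topspace (prod_topology Z (K i)). \<theta> p \<in> R}"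
      by (rule openin_continuous_map_preimage) fact
    have "continuous_map (prod_topology Z (K i)) (prod_topology (T i) (K i)) (\<lambda>p. (\<pi> i (fst p), snd p))"
      by (intro continuous_map_pairedI \<pi>1 continuous_map_snd)
    then have closedG: "closedin (prod_topology Z (K i)) {p \<in> topspace (prod_topology Z (K i)).
        (\<pi> i (fst p), snd p) \<in> {(u, v). u \<in> topspace (T i) \<and> v \<in> cl i u}}"
      by (rule closedin_continuous_map_preimage) (simp add: cl_def closedin_graph_closure)
    have \<pi>A: "openin Z {z \<in> topspace Z. \<pi> i z \<in> {x \<in> topspace (T i). a \<in> A i x}}"
      using a_open[OF i] ab topK[OF i] unfolding open_lower_sections_def K_def[symmetric] T_def[symmetric]
      by (intro openin_continuous_map_preimage[OF \<pi>]) simp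
    have \<rho>F: "openin Z {z \<in> topspace Z. \<rho> i z \<in> {y \<in> topspace (T i). b \<in> F i y}}"
      using a_open[OF i] ab topK[OF i] unfolding open_lower_sections_def K_def[symmetric] T_def[symmetric]
      by (intro openin_continuous_map_preimage[OF \<rho>]) simp
    have cl_sub: "u \<in> topspace (K i) \<and> u \<in> cl i x \<longleftrightarrow> u \<in> cl i x" for u x
      using graph_closure_subset[of "T i" "K i"] unfolding cl_def by blast
    \<comment> \<open>The lower section at \<open>(a, b)\<close> consists of two pulled-back lower sections and of the points at
       which the condition on \<open>f\<close> holds along the compact fibre.\<close>
    have "{z \<in> topspace Z. k \<in> S i z} =
        {z \<in> topspace Z. \<pi> i z \<in> {x \<in> topspace (T i). a \<in> A i x}} \<inter>
        {z \<in> topspace Z. \<rho> i z \<in> {y \<in> topspace (T i). b \<in> F i y}} \<inter>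
        {z \<in> topspace Z. \<forall>u. (z, u) \<in> {p \<in> topspace (prod_topology Z (K i)).
            (\<pi> i (fst p), snd p) \<in> {(u, v). u \<in> topspace (T i) \<and> v \<in> cl i u}} \<longrightarrow>
          (z, u) \<in> {p \<in> topspace (prod_topology Z (K i)). \<theta> p \<in> R}}"
      using \<pi>T \<rho>T by (auto simp: ab(1) S_def \<theta>_def R_def P_def topT cl_sub; blast)
    then show ?thesis
      using openin_forall_compact[OF compK[OF i] closedG openR] \<pi>A \<rho>F by (simp add: openin_Int)
  qed
  obtain z where z: "z \<in> topspace Z" "\<And>i. i \<in> {1..n} \<Longrightarrow> z i \<in> S i z"
    using family_fixed_point[of "{1..n}" EE "\<lambda>i. X i \<times> X i" S, OF _ E2 X2, folded Z_def] S lower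
    by auto
  define x where "x = (\<lambda>i\<in>{1..n}. fst (z i))"
  define y where "y = (\<lambda>i\<in>{1..n}. snd (z i))"
  have \<pi>x: "\<pi> i z = others n i x" and \<rho>y: "\<rho> i z = others n i y" for i
    by (auto simp: \<pi>_def \<rho>_def x_def y_def others_def)
  have upd: "(others n i w)(i := w i) = w" if "i \<in> {1..n}" "w \<in> extensional {1..n}" for i and w :: "nat \<Rightarrow> 'e"
    using that by (auto simp: others_def extensional_def fun_eq_iff)
  have xX: "x \<in> profiles n X" and yX: "y \<in> profiles n X"
    using z(1) topK by (auto simp: Zdef x_def y_def profiles_def PiE_iff mem_Times_iff)
  have "x i \<in> A i (others n i x) \<and> y i \<in> F i (others n i y) \<and>
      (\<forall>u\<in>A i (others n i x). f i x y u \<subseteq> C i (others n i x))" if i: "i \<in> {1..n}" for i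
  proof -
    have "(x i, y i) \<in> S i z"
      using z(2)[OF i] i by (simp add: x_def y_def)
    then have *: "x i \<in> A i (others n i x)" "y i \<in> F i (others n i y)"
      "\<And>u. u \<in> cl i (others n i x) \<Longrightarrow> f i x y u \<subseteq> Y i interior_of C i (others n i x)"
      using upd[OF i, of x] upd[OF i, of y] by (auto simp: S_def \<pi>x \<rho>y x_def y_def)
    have "others n i x \<in> topspace (T i)"
      using \<pi>T[OF z(1), of i] by (simp add: \<pi>x topT)
    then have "u \<in> cl i (others n i x)" if "u \<in> A i (others n i x)" for u
      using that a_A[OF i, of "others n i x"] topK[OF i]
      unfolding cl_def by (intro subset_graph_closure) (auto simp: topT)
    then show ?thesis
      using * interior_of_subset[of "Y i" "C i (others n i x)"] by (meson subset_trans)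
  qed
  then show ?thesis
    by (intro bexI[OF _ xX] bexI[OF _ yX] ballI)
qed

end
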